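(* Let $u=u_0u_1\dots u_{k-1}$ be a word over $\Sigma$ with $u_0=0$ and $k\ge 2$. Then $\Delta(\mathrm{K}(u))=\mathrm{T}(\Delta_T(u))$, i.e. for all $n\ge1$, $\mathrm{K}(u)(n)-\mathrm{K}(u)(n-1)=\mathrm{T}(\Delta(u)\,\rho_{-u_{k-1}})(n)$.
   Context: $\Sigma$ is a fixed finite cyclic (additive) group. Keane product on finite words over $\Sigma$: $u\times\varepsilon=\varepsilon$, $u\times(a v)=(u+a)(u\times v)$, where $u+a$ adds $a$ to every letter of $u$. Set $u^{\times 0}=0$, $u^{\times(n+1)}=u\times u^{\times n}$. For $u$ with $u_0=0$ and $|u|\ge2$, the Keane word $\mathrm{K}(u)=\lim_n u^{\times n}$ is an infinite word indexed by $0,1,2,\dots$. The first difference of a word $x=x_0x_1\dots$ is $\Delta(x)=(x_1-x_0)(x_2-x_1)\dots$ (empty if $|x|=1$); for infinite $x$ it is indexed so that $\Delta(x)(n)=x_n-x_{n-1}$, $n\ge1$. $\Delta_T(u)=\Delta(u)\,\rho_d$ with $d=-u_{|u|-1}$, where $\rho_d$ is the bijection $x\mapsto x+d$ of $\Sigma$. Toeplitz words: gaps are bijections of $\Sigma$; for words $x,y$ over $\Sigma\cup\mathrm{S}_\Sigma$, $x\langle y\rangle$ fills the gaps of $x$ in order: $(a\,x)\langle y\rangle=a\,x\langle y\rangle$, $(f\,x)\langle b\,y\rangle=f(b)\,x\langle y\rangle$, $(f\,x)\langle g\,y\rangle=(f\circ g)\,x\langle y\rangle$. For a pattern $P$ with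 first symbol in $\Sigma$, $T_0=?^\omega$ ($?$ the identity), $T_{i+1}=P^\omega\langle T_i\rangle$, $\mathrm{T}(P)=\lim_iT_i$, indexed by positive integers. *)

theory Defs
  imports "HOL-Library.Stream" "HOL-Combinatorics.Perm"
begin

text \<open>
  \<^typ>\<open>'a list\<close> is the type of finite words and \<^typ>\<open>'a stream\<close> the type of infinite words.
  Positions of a stream are counted from \<open>0\<close> by \<open>!!\<close>; for an infinite word \<open>y\<close> which is indexed
  by the positive integers, \<open>y(n)\<close> is therefore \<open>y !! (n - 1)\<close>.
\<close>

definition cyclic :: "'a::ab_group_add itself \<Rightarrow> bool" where
  "cyclic _ \<longleftrightarrow> (\<exists>g::'a. \<forall>x::'a. \<exists>n::nat. x = (\<Sum>i<n. g) \<or> x = - (\<Sum>i<n. g))"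

subsection \<open>Keane words\<close>

definition translate :: "'a::ab_group_add list \<Rightarrow> 'a \<Rightarrow> 'a list" where
  "translate u a = map (\<lambda>b. b + a) u"

primrec keane_prod :: "'a::ab_group_add list \<Rightarrow> 'a list \<Rightarrow> 'a list" where
  "keane_prod u [] = []"
| "keane_prod u (a # v) = translate u a @ keane_prod u v"

primrec keane_power :: "'a::ab_group_add list \<Rightarrow> nat \<Rightarrow> 'a list" where
  "keane_power u 0 = [0]"
| "keane_power u (Suc n) = keane_prod u (keane_power u n)"

text \<open>Limits are taken letter by letter, i.e. in the product of the discrete topologies.\<close>

definition list_limit :: "(nat \<Rightarrow> 'a list) \<Rightarrow> 'a stream \<Rightarrow> bool" where
  "list_limit w x \<longleftrightarrow>
     (\<forall>m. eventually (\<lambda>n. m < length (w n) \<and> w n ! m = x !! m) sequentially)"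

definition stream_limit :: "(nat \<Rightarrow> 'a stream) \<Rightarrow> 'a stream \<Rightarrow> bool" where
  "stream_limit w x \<longleftrightarrow> (\<forall>m. eventually (\<lambda>n. w n !! m = x !! m) sequentially)"

definition keane_word :: "'a::ab_group_add list \<Rightarrow> 'a stream" where
  "keane_word u = (THE x. list_limit (keane_power u) x)"

subsection \<open>Toeplitz words\<close>

text \<open>
  Symbols from the disjoint union of the alphabet and its symmetric group. Over a finite alphabet
  \<^typ>\<open>'a perm\<close> consists of all bijections.
\<close>

datatype 'a symbol = Letter 'a | Gap "'a perm"

primcorec fill :: "'a symbol stream \<Rightarrow> 'a symbol stream \<Rightarrow> 'a symbol stream" where
  "shd (fill x y) =
     (case shd x of
        Letter a \<Rightarrow> Letter a
      | Gap f \<Rightarrow> (case shd y of Letter b \<Rightarrow> Letter (Perm.apply f b) | Gap g \<Rightarrow> Gap (f * g)))"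
| "stl (fill x y) = fill (stl x) (case shd x of Letter a \<Rightarrow> y | Gap f \<Rightarrow> stl y)"

primrec toeplitz_iter :: "'a symbol list \<Rightarrow> nat \<Rightarrow> 'a symbol stream" where
  "toeplitz_iter P 0 = sconst (Gap 1)"
| "toeplitz_iter P (Suc i) = fill (Stream.cycle P) (toeplitz_iter P i)"

definition toeplitz_word :: "'a symbol list \<Rightarrow> 'a symbol stream" where
  "toeplitz_word P = (THE x. stream_limit (toeplitz_iter P) x)"

subsection \<open>First differences\<close>

definition diff_list :: "'a::ab_group_add list \<Rightarrow> 'a list" where
  "diff_list x = map2 (-) (tl x) x"

text \<open>Indexed by the positive integers: \<open>\<Delta>(x)(n) = x(n) - x(n - 1)\<close> is at position \<open>n - 1\<close>.\<close>

definition diff_stream :: "'a::ab_group_add stream \<Rightarrow> 'a stream" where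
  "diff_stream x = smap2 (-) (stl x) x"

lift_definition rho :: "'a::{finite, ab_group_add} \<Rightarrow> 'a perm" is "\<lambda>d x. x + d"
  by (auto intro: bij_betw_byWitness[where f' = "\<lambda>x. x - d" for d])

definition diff_pattern :: "'a::{finite, ab_group_add} list \<Rightarrow> 'a symbol list" where
  "diff_pattern u = map Letter (diff_list u) @ [Gap (rho (- last u))]"

end

theory Submission
  imports Defs
begin

text \<open>
  Write \<open>k = |u|\<close>. The Keane word satisfies \<open>K(kq + r) = u\<^sub>r + K(q)\<close> for \<open>r < k\<close>, so its first
  difference \<open>D\<close> satisfies \<open>D(kq + r) = u\<^sub>r - u\<^bsub>r-1\<^esub>\<close> for \<open>0 < r < k\<close> and
  \<open>D(kq) = D(q) - u\<^bsub>k-1\<^esub>\<close> since \<open>u\<^sub>0 = 0\<close>. These are the self-similarity equations of the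
  Toeplitz word, and they determine it: the \<open>i\<close>-th Toeplitz iterate agrees with \<open>D\<close> at all
  positions below \<open>k\<^sup>i\<close>.
\<close>

subsection \<open>Uniqueness of limits\<close>

lemma list_limit_unique:
  assumes "list_limit w x" "list_limit w y"
  shows "x = y"
proof -
  have "x !! m = y !! m" for m
  proof -
    have "eventually (\<lambda>n. x !! m = y !! m) sequentially"
      using assms[unfolded list_limit_def, THEN spec[of _ m]] by eventually_elim simp
    then show ?thesis by simp
  qed
  \<comment> \<open>At \<open>id\<close>, \<open>smap_alt\<close> serves as extensionality: streams
    agreeing at every position are equal.\<close>
  then show ?thesis using smap_alt[of id x y] by (simp add: stream.map_id)
qed

lemma stream_limit_unique:
  assumes "stream_limit w x" "stream_limit w y"
  shows "x = y"
proof -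
  have "x !! m = y !! m" for m
  proof -
    have "eventually (\<lambda>n. x !! m = y !! m) sequentially"
      using assms[unfolded stream_limit_def, THEN spec[of _ m]] by eventually_elim simp
    then show ?thesis by simp
  qed
  then show ?thesis using smap_alt[of id x y] by (simp add: stream.map_id)
qed

lemma keane_word_eqI: "list_limit (keane_power u) x \<Longrightarrow> keane_word u = x"
  unfolding keane_word_def by (blast intro: the_equality list_limit_unique)

lemma toeplitz_word_eqI: "stream_limit (toeplitz_iter P) x \<Longrightarrow> toeplitz_word P = x"
  unfolding toeplitz_word_def by (blast intro: the_equality stream_limit_unique)

lemma eventually_less_power:
  fixes k m :: nat
  assumes "k \<ge> 2"
  shows "eventually (\<lambda>n. m < k ^ n) sequentially"
  using eventually_ge_at_top[of m]
proof eventually_elim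
  case (elim n)
  also have "n < k ^ n" using assms by (simp add: power_gt_expt)
  finally show ?case .
qed

subsection \<open>Letters of the Keane word\<close>

lemma length_keane_prod: "length (keane_prod u v) = length u * length v"
  by (induction v) (auto simp: translate_def)

lemma length_keane_power: "length (keane_power u n) = length u ^ n"
  by (induction n) (auto simp: length_keane_prod)

text \<open>The product consists of blocks of length \<open>length u\<close>; block \<open>q\<close>
  is \<open>u\<close> translated by the letter \<open>v ! q\<close>.\<close>

lemma nth_keane_prod:
  assumes "q < length v" "r < length u"
  shows "keane_prod u v ! (length u * q + r) = u ! r + v ! q"
  using assms
proof (induction v arbitrary: q)
  case (Cons a v)
  then show ?case
    by (cases q) (auto simp: translate_def nth_append)
qed simp

text \<open>The guard \<open>length u < 2\<close> only serves termination.\<close>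

function keane_letter :: "'a::ab_group_add list \<Rightarrow> nat \<Rightarrow> 'a" where
  "keane_letter u m =
     (if m = 0 \<or> length u < 2 then 0
      else u ! (m mod length u) + keane_letter u (m div length u))"
  by pat_completeness auto
termination
  by (relation "measure snd") auto

declare keane_letter.simps [simp del]

lemma keane_letter_0 [simp]: "keane_letter u 0 = 0"
  by (simp add: keane_letter.simps)

lemma keane_letter_mult_add:
  assumes "length u \<ge> 2" "u ! 0 = 0" "r < length u"
  shows "keane_letter u (length u * q + r) = u ! r + keane_letter u q"
proof -
  have "u \<noteq> []" using assms(3) by auto
  then have "(length u * q + r) div length u = q" "(length u * q + r) mod length u = r"
    using assms by simp_all
  then show ?thesis
    \<comment> \<open>The recursion stops at \<open>0\<close>, which forces
      \<open>q = r = 0\<close>; there \<open>u ! 0 = 0\<close> makes the equation hold all the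
      same.\<close>
    using assms by (subst keane_letter.simps) (cases "length u * q + r = 0", auto)
qed

text \<open>Both sides add up the letters of \<open>u\<close> selected by the
  base-\<open>length u\<close> digits of \<open>m\<close>. Leading zero digits contribute
  \<open>u ! 0 = 0\<close>, so the value is the same for every large enough
  \<open>n\<close>.\<close>

lemma nth_keane_power:
  assumes "length u \<ge> 2" "u ! 0 = 0" "m < length u ^ n"
  shows "keane_power u n ! m = keane_letter u m"
  using assms(3)
proof (induction n arbitrary: m)
  case (Suc n)
  define q r where "q = m div length u" and "r = m mod length u"
  have m: "m = length u * q + r" by (simp add: q_def r_def)
  have r: "r < length u" unfolding r_def using assms(1) by (intro mod_less_divisor) linarith
  have q: "q < length u ^ n"
    using Suc.prems by (simp add: q_def less_mult_imp_div_less mult.commute)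
  show ?case
    using Suc.IH[OF q] nth_keane_prod[of q "keane_power u n" r u]
      keane_letter_mult_add[OF assms(1,2) r, of q] q r
    by (simp add: m length_keane_power)
qed simp

lemma keane_word_eq_keane_letter:
  assumes "length u \<ge> 2" "u ! 0 = 0"
  shows "keane_word u = smap (keane_letter u) nats"
proof (rule keane_word_eqI)
  show "list_limit (keane_power u) (smap (keane_letter u) nats)"
    unfolding list_limit_def
  proof
    fix m
    show "eventually (\<lambda>n. m < length (keane_power u n) \<and>
            keane_power u n ! m = smap (keane_letter u) nats !! m) sequentially"
      using eventually_less_power[OF assms(1), of m]
      by eventually_elim (simp add: length_keane_power nth_keane_power[OF assms])
  qed
qed

lemma snth_keane_word_mult_add:
  assumes "length u \<ge> 2" "u ! 0 = 0" "r < length u"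
  shows "keane_word u !! (length u * q + r) = u ! r + keane_word u !! q"
  using assms by (simp add: keane_word_eq_keane_letter keane_letter_mult_add)

subsection \<open>Filling a periodic word with one gap per period\<close>

definition act :: "'a perm \<Rightarrow> 'a symbol \<Rightarrow> 'a symbol" where
  "act f s = (case s of Letter b \<Rightarrow> Letter (Perm.apply f b) | Gap g \<Rightarrow> Gap (f * g))"

lemma fill_Letter: "fill (Letter a ## x) y = Letter a ## fill x y"
  by (subst fill.code) simp

lemma fill_Gap: "fill (Gap f ## x) y = act f (shd y) ## fill x (stl y)"
  by (subst fill.code) (simp add: act_def)

lemma fill_shift: "fill (map Letter v @- x) y = map Letter v @- fill x y"
  by (induction v) (auto simp: fill_Letter)

lemma fill_cycle:
  "fill (Stream.cycle (map Letter v @ [Gap f])) y =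
     map Letter v @- (act f (shd y) ## fill (Stream.cycle (map Letter v @ [Gap f])) (stl y))"
proof -
  let ?c = "Stream.cycle (map Letter v @ [Gap f])"
  have "?c = (map Letter v @ [Gap f]) @- ?c"
    by (rule Stream.cycle_decomp) simp
  then have "?c = map Letter v @- (Gap f ## ?c)" by simp
  then have "fill ?c y = fill (map Letter v @- (Gap f ## ?c)) y" by (rule arg_cong)
  then show ?thesis by (simp only: fill_shift fill_Gap)
qed

text \<open>Each period uses up exactly one symbol of \<open>y\<close>, at its last position, so the
  gap of period \<open>q\<close> receives \<open>y !! q\<close>. The induction therefore replaces
  \<open>y\<close> by its tail.\<close>

lemma snth_fill_cycle:
  assumes "r \<le> length v"
  shows "fill (Stream.cycle (map Letter v @ [Gap f])) y !! (Suc (length v) * q + r) =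
    (if r < length v then Letter (v ! r) else act f (y !! q))"
proof (induction q arbitrary: y)
  case 0
  show ?case using assms by (subst fill_cycle) auto
next
  case (Suc q)
  have "Suc (length v) * Suc q + r = length v + Suc (Suc (length v) * q + r)" by simp
  then show ?case
    using Suc[of "stl y"] by (subst fill_cycle) (simp only: shift_snth_ge length_map le_add1
        add_diff_cancel_left' snth.simps stream.sel)
qed

subsection \<open>The first difference of the Keane word\<close>

lemma snth_diff_stream: "diff_stream x !! n = x !! Suc n - x !! n"
  by (simp add: diff_stream_def)

lemma apply_rho: "Perm.apply (rho d) x = x + d"
  by transfer simp

lemma length_diff_list: "length (diff_list u) = length u - 1"
  by (simp add: diff_list_def)

lemma nth_diff_list: "Suc r < length u \<Longrightarrow> diff_list u ! r = u ! Suc r - u ! r"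
  by (simp add: diff_list_def nth_tl)

text \<open>Inside a block the common summand \<open>keane_word u !! q\<close> cancels. At the end
  of a block the next letter opens block \<open>q + 1\<close> and equals
  \<open>keane_word u !! Suc q\<close>, because \<open>u ! 0 = 0\<close>.\<close>

lemma snth_diff_stream_keane_word:
  assumes "length u \<ge> 2" "u ! 0 = 0" "r < length u"
  shows "diff_stream (keane_word u) !! (length u * q + r) =
    (if Suc r < length u then u ! Suc r - u ! r
     else diff_stream (keane_word u) !! q + (- last u))"
proof (cases "Suc r < length u")
  case True
  have "keane_word u !! Suc (length u * q + r) = u ! Suc r + keane_word u !! q"
    using snth_keane_word_mult_add[OF assms(1,2) True] by (simp only: add_Suc_right)
  then show ?thesis
    using True snth_keane_word_mult_add[OF assms] by (simp add: snth_diff_stream del: snth.simps)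
next
  case False
  with assms have r: "Suc r = length u" by simp
  have u: "u \<noteq> []" using assms(3) by auto
  then have "last u = u ! r" by (simp add: last_conv_nth flip: r)
  moreover have "keane_word u !! Suc (length u * q + r) = keane_word u !! Suc q"
  proof -
    have "Suc (length u * q + r) = length u * Suc q + 0" using r by simp
    then show ?thesis
      using snth_keane_word_mult_add[OF assms(1,2), of 0 "Suc q"] u assms(2)
      by (simp only: length_greater_0_conv add_0_left simp_thms)
  qed
  ultimately show ?thesis
    using False snth_keane_word_mult_add[OF assms] by (simp add: snth_diff_stream del: snth.simps)
qed

text \<open>
  Position \<open>m\<close> stands for the index \<open>m + 1\<close>, hence the bound on \<open>Suc m\<close>.
\<close>

lemma snth_toeplitz_iter_diff_pattern:
  assumes "length u \<ge> 2" "u ! 0 = 0" "Suc m < length u ^ i"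
  shows "toeplitz_iter (diff_pattern u) i !! m = Letter (diff_stream (keane_word u) !! m)"
  using assms(3)
proof (induction i arbitrary: m)
  case (Suc i)
  define q r where "q = m div length u" and "r = m mod length u"
  have m: "m = length u * q + r" by (simp add: q_def r_def)
  have r: "r < length u" unfolding r_def using assms(1) by (intro mod_less_divisor) linarith
  have len: "Suc (length (diff_list u)) = length u"
    using assms(1) by (simp add: length_diff_list)
  have "r \<le> length (diff_list u)" using r len by simp
  note fill = snth_fill_cycle[OF this, of "rho (- last u)" "toeplitz_iter (diff_pattern u) i" q,
      unfolded len, folded m diff_pattern_def]
  note diff = snth_diff_stream_keane_word[OF assms(1,2) r, of q, folded m]
  show ?case
  proof (cases "Suc r < length u")
    case True
    then show ?thesis using fill diff len by (simp add: nth_diff_list)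
  next
    case False
    \<comment> \<open>Counted from \<open>1\<close>, gaps sit at the multiples of
      \<open>length u\<close>, so dividing the bound on \<open>Suc m\<close> by
      \<open>length u\<close> gives exactly the bound that the induction hypothesis needs.\<close>
    with r have "Suc m = length u * Suc q" by (simp add: m)
    with Suc.prems have "Suc q < length u ^ i"
      by (simp del: mult_Suc_right)
    from Suc.IH[OF this] show ?thesis
      using fill diff len False by (simp add: act_def apply_rho)
  qed
qed simp

lemma toeplitz_word_diff_pattern:
  assumes "length u \<ge> 2" "u ! 0 = 0"
  shows "toeplitz_word (diff_pattern u) = smap Letter (diff_stream (keane_word u))"
proof (rule toeplitz_word_eqI)
  show "stream_limit (toeplitz_iter (diff_pattern u)) (smap Letter (diff_stream (keane_word u)))"
    unfolding stream_limit_def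
  proof
    fix m
    show "eventually (\<lambda>i. toeplitz_iter (diff_pattern u) i !! m =
            smap Letter (diff_stream (keane_word u)) !! m) sequentially"
      using eventually_less_power[OF assms(1), of "Suc m"]
      by eventually_elim (simp add: snth_toeplitz_iter_diff_pattern[OF assms])
  qed
qed

theorem mainTheorem3:
  fixes u :: "'a::{finite, ab_group_add} list" and k :: nat
  assumes "cyclic TYPE('a)"
    and "length u = k" and "k \<ge> 2" and "u ! 0 = 0"
  shows "smap Letter (diff_stream (keane_word u)) = toeplitz_word (diff_pattern u) \<and>
    (\<forall>n\<ge>1. Letter (keane_word u !! n - keane_word u !! (n - 1)) =
      toeplitz_word (map Letter (diff_list u) @ [Gap (rho (- (u ! (k - 1))))]) !! (n - 1))"
proof -
  have len: "length u \<ge> 2" using assms by simp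
  then have "u \<noteq> []" by auto
  then have pattern: "map Letter (diff_list u) @ [Gap (rho (- (u ! (k - 1))))] = diff_pattern u"
    using assms(2) by (simp add: diff_pattern_def last_conv_nth)
  show ?thesis
    unfolding pattern toeplitz_word_diff_pattern[OF len assms(4)]
    by (auto simp: snth_diff_stream)
qed

end
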